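(* Let $M\ge 1$ be an integer. Suppose that $\{\tau_{in}\mid n=1,2,\ldots\}$, $i=0,1,\ldots,M$, are mutually independent sequences, each consisting of independent and identically distributed nonnegative random variables with $0\le \mathbb{E}[\tau_{i1}]<\infty$ for all $i=0,1,\ldots,M$. Let $D_i(n)$, $i=0,\ldots,M$, $n\ge 0$, be defined by $D_i(0)=0$ for all $i=0,\ldots,M$ and, for $n=1,2,\ldots$, $$D_0(n)=D_0(n-1)+\tau_{0n},\qquad D_m(n)=\max\bigl(D_{m-1}(n),D_m(n-1)\bigr)+\tau_{mn},\quad m=1,\ldots,M.$$ Then the limit $$\gamma=\lim_{n\to\infty}\frac{1}{n}D_M(n)$$ exists with probability one. If, moreover, the variances satisfy $\mathbb{D}[\tau_{i1}]<\infty$ for all $i=0,1,\ldots,M$, then this limit is given by $$\gamma=\max_{0\le i\le M}\mathbb{E}[\tau_{i1}].$$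
   Context: $\mathbb{E}$ denotes expectation and $\mathbb{D}$ denotes variance. The setting models a tandem of $M$ single-server queues with infinite buffers, initially empty: $\tau_{0n}$ is the interarrival time between the $(n-1)$st and $n$th customers, $\tau_{in}$ ($1\le i\le M$) is the service time of the $n$th customer at server $i$, $D_0(n)$ is the $n$th arrival epoch, and $D_i(n)$ is the $n$th departure epoch from server $i$. The limit $\gamma$ is called the mean (service) cycle time. *)

theory Defs
  imports "HOL-Probability.Probability"
begin

text \<open>Departure epochs along one sample path: \<open>t i n\<close> is the realisation of \<open>\<tau>\<^sub>i\<^sub>n\<close>, with customers
  numbered from 1, so the values \<open>t i 0\<close> are never used.\<close>

fun departure :: "(nat \<Rightarrow> nat \<Rightarrow> real) \<Rightarrow> nat \<Rightarrow> nat \<Rightarrow> real" where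
  "departure t i 0 = 0"
| "departure t 0 (Suc n) = departure t 0 n + t 0 (Suc n)"
| "departure t (Suc m) (Suc n) =
     max (departure t m (Suc n)) (departure t (Suc m) n) + t (Suc m) (Suc n)"

end

theory Submission
  imports Defs
begin

text \<open>Let \<open>S\<^sub>m(n)\<close> be the partial sums of
  the service times at server \<open>m\<close>. Then \<open>D\<^sub>m(n) - S\<^sub>m(n)\<close> is the running maximum, started from 0, of
  \<open>D\<^sub>m\<^sub>-\<^sub>1(k) - S\<^sub>m(k - 1)\<close>, so linear growth of \<open>D\<^sub>m\<^sub>-\<^sub>1\<close> at rate \<open>a\<close> and of \<open>S\<^sub>m\<close> at rate \<open>b\<close> gives
  linear growth of \<open>D\<^sub>m\<close> at rate \<open>max (a - b) 0 + b = max a b\<close>, path by path. The rates of the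
  partial sums come from the strong law of large numbers, proved by Etemadi's argument: along
  \<open>k\<^sub>n = \<lceil>\<alpha>\<^sup>n\<rceil>\<close> one truncates all variables of the \<open>n\<close>th block at the same level \<open>\<alpha>\<^sup>n\<close>, so that the
  truncation error and the Chebyshev bound are both summable, being dominated by geometric sums of
  size \<open>O(E[X])\<close>; monotonicity of the partial sums fills the gaps as \<open>\<alpha>\<close> tends to 1.\<close>

section \<open>Sample paths\<close>

text \<open>From below, \<open>U n\<close> dominates both \<open>V n\<close> and 0. From above, a
  line \<open>K + b * n\<close> of slope slightly above \<open>max c 0\<close> dominates all of
  \<open>V\<close>, and since its slope is positive it dominates the running maximum too.\<close>

lemma running_max_linear_growth:
  fixes U V :: "nat \<Rightarrow> real"
  assumes U0: "U 0 = 0"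
    and USuc: "\<And>n. U (Suc n) = max (V (Suc n)) (U n)"
    and V: "(\<lambda>n. V n / real n) \<longlonglongrightarrow> c"
  shows "(\<lambda>n. U n / real n) \<longlonglongrightarrow> max c 0"
proof (rule order_tendstoI)
  fix a assume a: "a < max c 0"
  have nonneg: "0 \<le> U n" for n
    by (induction n) (auto simp: U0 USuc)
  have "V n \<le> U n" if "n \<ge> 1" for n
    using that by (cases n) (auto simp: USuc)
  then have ge: "max (V n / n) 0 \<le> U n / n" if "n \<ge> 1" for n
    using that nonneg by (auto simp: divide_right_mono)
  have "(\<lambda>n. max (V n / n) 0) \<longlonglongrightarrow> max c 0"
    by (intro tendsto_intros V)
  then have "\<forall>\<^sub>F n in sequentially. a < max (V n / n) 0"
    using a by (rule order_tendstoD)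
  then show "\<forall>\<^sub>F n in sequentially. a < U n / n"
    using eventually_ge_at_top[of 1]
    by eventually_elim (use ge in force)
next
  fix a assume a: "max c 0 < a"
  \<comment> \<open>The midpoint gives three things: \<open>b > c\<close> puts \<open>V n\<close>
    eventually below \<open>b * n\<close>, \<open>b > 0\<close> makes the line increasing, and
    \<open>b < a\<close> leaves room for the vanishing term \<open>K / n\<close>.\<close>
  define b where "b = (max c 0 + a) / 2"
  have b: "c < b" "0 < b" "b < a" using a by (auto simp: b_def)
  obtain N where N: "\<And>n. n \<ge> N \<Longrightarrow> V n / n < b"
    using order_tendstoD(2)[OF V b(1)] by (auto simp: eventually_sequentially)
  \<comment> \<open>A crude intercept that absorbs the finitely many indices below
    \<open>N\<close>.\<close>
  define K where "K = (\<Sum>n<N. \<bar>V n\<bar>)"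
  have "0 \<le> K" by (simp add: K_def sum_nonneg)
  have V_le: "V n \<le> K + b * n" if "n \<ge> 1" for n
  proof (cases "n < N")
    case True
    then have "\<bar>V n\<bar> \<le> K" unfolding K_def by (intro member_le_sum) auto
    moreover have "0 \<le> b * n" using b by simp
    ultimately show ?thesis by linarith
  next
    case False
    then have "V n / n < b" using N by simp
    then show ?thesis using that \<open>0 \<le> K\<close> by (simp add: field_simps)
  qed
  have U_le: "U n \<le> K + b * n" for n
  proof (induction n)
    case 0 then show ?case using U0 \<open>0 \<le> K\<close> by simp
  next
    case (Suc n)
    have "b * n \<le> b * Suc n" using b by simp
    then show ?case using Suc V_le[of "Suc n"] by (simp add: USuc)
  qed
  have "(\<lambda>n. K / real n + b) \<longlonglongrightarrow> 0 + b"
    by (intro tendsto_intros lim_const_over_n)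
  then have "\<forall>\<^sub>F n in sequentially. K / n + b < a"
    using b(3) by (intro order_tendstoD) auto
  then show "\<forall>\<^sub>F n in sequentially. U n / n < a"
    using eventually_ge_at_top[of 1]
  proof eventually_elim
    case (elim n)
    have "U n / n \<le> (K + b * n) / n"
      using U_le by (intro divide_right_mono) auto
    then show ?case using elim by (simp add: add_divide_distrib)
  qed
qed

lemma tendsto_shift_over_n:
  fixes S :: "nat \<Rightarrow> real"
  assumes "(\<lambda>n. S n / real n) \<longlonglongrightarrow> b"
  shows "(\<lambda>n. S (n - 1) / real n) \<longlonglongrightarrow> b"
proof -
  have "(\<lambda>n. real n / real (Suc n)) \<longlonglongrightarrow> 1"
    by (rule LIMSEQ_n_over_Suc_n)
  with assms have "(\<lambda>n. S n / real n * (real n / real (Suc n))) \<longlonglongrightarrow> b * 1"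
    by (rule tendsto_mult)
  \<comment> \<open>The two sides may differ at \<open>n = 0\<close>, where the left one is 0 by
    division by zero and the right one is \<open>S 0\<close>; hence only eventual equality.\<close>
  moreover have "\<forall>\<^sub>F n in sequentially. S n / real n * (real n / real (Suc n)) = S n / real (Suc n)"
    using eventually_ge_at_top[of 1] by eventually_elim simp
  ultimately have "(\<lambda>n. S n / real (Suc n)) \<longlonglongrightarrow> b * 1"
    by (rule Lim_transform_eventually)
  then show ?thesis by (subst filterlim_sequentially_Suc[symmetric]) simp
qed

lemma departure_zero: "departure t 0 n = (\<Sum>k=1..n. t 0 k)"
  by (induction n) auto

lemma departure_rate:
  assumes "\<And>i. i \<le> m \<Longrightarrow> (\<lambda>n. (\<Sum>k=1..n. t i k) / real n) \<longlonglongrightarrow> \<mu> i"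
  shows "(\<lambda>n. departure t m n / real n) \<longlonglongrightarrow> Max (\<mu> ` {0..m})"
  using assms
proof (induction m)
  case 0
  then show ?case by (simp add: departure_zero)
next
  case (Suc m)
  define S where "S n = (\<Sum>k=1..n. t (Suc m) k)" for n
  define U where "U n = departure t (Suc m) n - S n" for n
  \<comment> \<open>The shift to \<open>n - 1\<close> arises because the service time of customer
    \<open>n\<close> is added after the maximum: subtracting \<open>S (Suc n)\<close> from the
    recursion leaves both arguments of \<open>max\<close> reduced by \<open>S n\<close>
    only.\<close>
  define V where "V n = departure t m n - S (n - 1)" for n
  have S: "(\<lambda>n. S n / real n) \<longlonglongrightarrow> \<mu> (Suc m)"
    using Suc.prems[of "Suc m"] by (simp add: S_def)
  have "(\<lambda>n. departure t m n / real n - S (n - 1) / real n) \<longlonglongrightarrow> Max (\<mu> ` {0..m}) - \<mu> (Suc m)"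
    by (intro tendsto_diff Suc tendsto_shift_over_n S) auto
  then have "(\<lambda>n. V n / real n) \<longlonglongrightarrow> Max (\<mu> ` {0..m}) - \<mu> (Suc m)"
    by (simp add: V_def diff_divide_distrib)
  then have "(\<lambda>n. U n / real n) \<longlonglongrightarrow> max (Max (\<mu> ` {0..m}) - \<mu> (Suc m)) 0"
    by (rule running_max_linear_growth[rotated 2]) (auto simp: U_def V_def S_def max_def)
  from tendsto_add[OF this S]
  have "(\<lambda>n. departure t (Suc m) n / real n)
      \<longlonglongrightarrow> max (Max (\<mu> ` {0..m}) - \<mu> (Suc m)) 0 + \<mu> (Suc m)"
    by (simp add: U_def diff_divide_distrib)
  also have "max (Max (\<mu> ` {0..m}) - \<mu> (Suc m)) 0 + \<mu> (Suc m) = Max (\<mu> ` {0..Suc m})"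
    unfolding max_add_distrib_left by (simp add: atLeast0_atMost_Suc max.commute)
  finally show ?case .
qed

section \<open>Geometric sums\<close>

text \<open>Each nonzero term is at most an increment of a capped geometric sequence divided by
  \<open>\<alpha> - 1\<close>; the increments telescope to at most the cap.\<close>

lemma sum_powers_below:
  fixes \<alpha> x :: real
  assumes "1 < \<alpha>" "0 \<le> x"
  shows "(\<Sum>n<N. if \<alpha> ^ n < x then \<alpha> ^ n else 0) \<le> \<alpha> / (\<alpha> - 1) * x"
proof -
  \<comment> \<open>With the cap at \<open>\<alpha> * x\<close> instead of \<open>x\<close>, the
    whole step from \<open>\<alpha> ^ n\<close> to \<open>\<alpha> ^ Suc n\<close> stays under the
    cap whenever \<open>\<alpha> ^ n < x\<close>.\<close>
  define p where "p n = min (\<alpha> ^ n) (\<alpha> * x)" for n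
  have "(if \<alpha> ^ n < x then \<alpha> ^ n else 0) \<le> (p (Suc n) - p n) / (\<alpha> - 1)" for n
  proof (cases "\<alpha> ^ n < x")
    case True
    then have "\<alpha> ^ n \<le> \<alpha> * x" "\<alpha> * \<alpha> ^ n \<le> \<alpha> * x"
      using assms mult_right_mono[of 1 \<alpha> x] by auto
    then show ?thesis using True assms by (simp add: p_def field_simps)
  next
    case False
    have "p n \<le> p (Suc n)" using assms unfolding p_def by (intro min.mono power_increasing) auto
    then show ?thesis using False assms by simp
  qed
  then have "(\<Sum>n<N. if \<alpha> ^ n < x then \<alpha> ^ n else 0) \<le> (\<Sum>n<N. (p (Suc n) - p n) / (\<alpha> - 1))"
    by (rule sum_mono)
  also have "\<dots> = (p N - p 0) / (\<alpha> - 1)"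
    by (simp add: sum_divide_distrib[symmetric] sum_lessThan_telescope)
  also have "\<dots> \<le> \<alpha> * x / (\<alpha> - 1)"
  proof (rule divide_right_mono)
    have "p N \<le> \<alpha> * x" "0 \<le> p 0" using assms by (auto simp: p_def)
    then show "p N - p 0 \<le> \<alpha> * x" by linarith
  qed (use assms in simp)
  finally show ?thesis by simp
qed

text \<open>The mirror image of the previous telescoping, with decrements of the inverse powers
  capped at \<open>1 / x\<close>; their total is at most \<open>1 / x\<close>, which cancels one
  factor of \<open>x\<^sup>2\<close>.\<close>

lemma sum_inverse_powers_above:
  fixes \<alpha> x :: real
  assumes "1 < \<alpha>" "0 \<le> x"
  shows "(\<Sum>n<N. if x \<le> \<alpha> ^ n then x\<^sup>2 / \<alpha> ^ n else 0) \<le> \<alpha> / (\<alpha> - 1) * x"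
proof (cases "x = 0")
  case False
  with assms have x: "0 < x" by simp
  define q where "q n = min (1 / \<alpha> ^ n) (1 / x)" for n
  have "(if x \<le> \<alpha> ^ n then x\<^sup>2 / \<alpha> ^ n else 0) \<le> x\<^sup>2 * (\<alpha> / (\<alpha> - 1)) * (q n - q (Suc n))" for n
  proof (cases "x \<le> \<alpha> ^ n")
    case True
    \<comment> \<open>Once \<open>x \<le> \<alpha> ^ n\<close>, the cap is inactive at both
      \<open>n\<close> and \<open>Suc n\<close>, so the decrement is exactly
      \<open>(\<alpha> - 1) / \<alpha>\<close> times \<open>1 / \<alpha> ^ n\<close>.\<close>
    also have le: "\<alpha> ^ n \<le> \<alpha> ^ Suc n" using assms by (intro power_increasing) auto
    finally have "q n = 1 / \<alpha> ^ n" "q (Suc n) = 1 / \<alpha> ^ Suc n"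
      using True x assms unfolding q_def by (auto intro!: min.absorb1 divide_left_mono)
    then have eq: "(\<alpha> / (\<alpha> - 1)) * (q n - q (Suc n)) = 1 / \<alpha> ^ n"
      using assms by (simp add: field_simps)
    show ?thesis unfolding mult.assoc eq using True by simp
  next
    case False
    have "q (Suc n) \<le> q n" using assms x unfolding q_def
      by (intro min.mono divide_left_mono power_increasing) auto
    then show ?thesis using False assms by simp
  qed
  then have "(\<Sum>n<N. if x \<le> \<alpha> ^ n then x\<^sup>2 / \<alpha> ^ n else 0)
      \<le> (\<Sum>n<N. x\<^sup>2 * (\<alpha> / (\<alpha> - 1)) * (q n - q (Suc n)))"
    by (rule sum_mono)
  also have "\<dots> = x\<^sup>2 * (\<alpha> / (\<alpha> - 1)) * (q 0 - q N)"
    by (simp only: sum_distrib_left[symmetric] sum_lessThan_telescope')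
  also have "\<dots> \<le> x\<^sup>2 * (\<alpha> / (\<alpha> - 1)) * (1 / x)"
  proof (rule mult_left_mono)
    have "q 0 \<le> 1 / x" "0 \<le> q N" using assms x by (auto simp: q_def)
    then show "q 0 - q N \<le> 1 / x" by linarith
  qed (use assms in simp)
  also have "\<dots> = \<alpha> / (\<alpha> - 1) * x"
    using x by (simp add: power2_eq_square)
  finally show ?thesis .
next
  case True
  then have "(\<Sum>n<N. if x \<le> \<alpha> ^ n then x\<^sup>2 / \<alpha> ^ n else 0) = 0"
    by (intro sum.neutral) simp
  then show ?thesis using True by simp
qed

section \<open>Interpolation along geometric subsequences\<close>

text \<open>Rounding up has the advantage that a natural number at least \<open>\<alpha> ^ n\<close>
  is also at least \<open>geo \<alpha> n\<close>.\<close>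

definition geo :: "real \<Rightarrow> nat \<Rightarrow> nat" where
  "geo \<alpha> n = nat \<lceil>\<alpha> ^ n\<rceil>"

lemma geo_bounds:
  fixes \<alpha> :: real
  assumes "1 < \<alpha>"
  shows "\<alpha> ^ n \<le> geo \<alpha> n" "geo \<alpha> n \<le> \<alpha> ^ n + 1"
proof -
  have "1 \<le> \<alpha> ^ n" using assms by (intro one_le_power) simp
  then show "\<alpha> ^ n \<le> geo \<alpha> n" "geo \<alpha> n \<le> \<alpha> ^ n + 1"
    unfolding geo_def by linarith+
qed

text \<open>Monotonicity traps \<open>S n\<close> between the values at two consecutive geometric
  indices around \<open>n\<close>. Replacing these indices by \<open>n\<close> in the denominators
  costs a factor of at most \<open>\<alpha>\<close> on either side, up to a vanishing rounding
  error.\<close>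

lemma geometric_sandwich:
  fixes S :: "nat \<Rightarrow> real"
  assumes \<alpha>: "1 < \<alpha>" and S: "mono S" "\<And>n. 0 \<le> S n"
    and lim: "(\<lambda>n. S (geo \<alpha> n) / geo \<alpha> n) \<longlonglongrightarrow> \<mu>"
  shows "a < \<mu> / \<alpha> \<Longrightarrow> \<forall>\<^sub>F n in sequentially. a < S n / n"
    and "\<mu> * \<alpha> < a \<Longrightarrow> \<forall>\<^sub>F n in sequentially. S n / n < a"
proof -
  define R where "R n = S (geo \<alpha> n) / geo \<alpha> n" for n
  \<comment> \<open>For \<open>n \<ge> 1\<close> this is the largest exponent with
    \<open>\<alpha> ^ l n \<le> n\<close>.\<close>
  define l where "l n = nat \<lfloor>log \<alpha> (real n)\<rfloor>" for n
  have l: "\<alpha> ^ l n \<le> n" "n < \<alpha> ^ Suc (l n)" if "n \<ge> 1" for n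
  proof -
    have "0 \<le> log \<alpha> n" using \<alpha> that by simp
    then have "real (l n) \<le> log \<alpha> n" "log \<alpha> n < real (Suc (l n))"
      unfolding l_def by linarith+
    then have "\<alpha> powr real (l n) \<le> n" "n < \<alpha> powr real (Suc (l n))"
      using \<alpha> that by (simp_all add: le_log_iff log_less_iff)
    then show "\<alpha> ^ l n \<le> n" "n < \<alpha> ^ Suc (l n)"
      using \<alpha> by (simp_all only: powr_realpow)
  qed
  have l_top: "filterlim l at_top sequentially"
    unfolding filterlim_at_top
  proof
    fix Z
    obtain N where N: "\<alpha> ^ Z \<le> real N" using real_arch_simple by blast
    show "\<forall>\<^sub>F n in sequentially. Z \<le> l n"
      using eventually_ge_at_top[of "max N 1"]
    proof eventually_elim
      case (elim n)
      show ?case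
      proof (rule ccontr)
        assume "\<not> Z \<le> l n"
        then have "\<alpha> ^ Suc (l n) \<le> \<alpha> ^ Z" using \<alpha> by (intro power_increasing) auto
        then show False using l(2)[of n] N elim by simp
      qed
    qed
  qed
  have pos: "0 < real (geo \<alpha> n)" for n
    using geo_bounds(1)[OF \<alpha>, of n] \<alpha> by (smt (verit) zero_less_power)
  have R: "0 \<le> R n" "S (geo \<alpha> n) = R n * geo \<alpha> n" for n
    using pos[of n] S by (simp_all add: R_def)
  have lower: "R (l n) * (1 / \<alpha>) \<le> S n / n" if n: "n \<ge> 1" for n
  proof -
    have "geo \<alpha> (l n) \<le> n" using l(1)[OF n] by (simp add: geo_def ceiling_le_iff)
    then have "R (l n) * geo \<alpha> (l n) \<le> S n" using S(1) by (simp add: R(2)[symmetric] monoD)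
    moreover have "n / \<alpha> \<le> geo \<alpha> (l n)"
      using l(2)[OF n] geo_bounds(1)[OF \<alpha>, of "l n"] \<alpha>
      by (simp add: pos_divide_le_eq) (smt (verit) mult.commute mult_right_mono)
    then have "R (l n) * (n / \<alpha>) \<le> R (l n) * geo \<alpha> (l n)"
      using R(1) by (intro mult_left_mono) auto
    ultimately have "R (l n) * (n / \<alpha>) \<le> S n" by linarith
    then show ?thesis using n by (simp add: field_simps)
  qed
  \<comment> \<open>The term \<open>1 / n\<close> is the price of rounding: \<open>geo\<close>
    exceeds the power by at most 1.\<close>
  have upper: "S n / n \<le> R (Suc (l n)) * (\<alpha> + 1 / n)" if n: "n \<ge> 1" for n
  proof -
    have "n \<le> geo \<alpha> (Suc (l n))"
      using l(2)[OF n] geo_bounds(1)[OF \<alpha>, of "Suc (l n)"] by linarith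
    then have "S n \<le> R (Suc (l n)) * geo \<alpha> (Suc (l n))"
      using S(1) by (simp add: R(2)[symmetric] monoD)
    also have "\<alpha> * \<alpha> ^ l n \<le> \<alpha> * n"
      using l(1)[OF n] \<alpha> by (intro mult_left_mono) auto
    then have "geo \<alpha> (Suc (l n)) \<le> \<alpha> * n + 1"
      using geo_bounds(2)[OF \<alpha>, of "Suc (l n)"] unfolding power_Suc by linarith
    then have "R (Suc (l n)) * geo \<alpha> (Suc (l n)) \<le> R (Suc (l n)) * (\<alpha> * n + 1)"
      using R(1) by (intro mult_left_mono) auto
    also have "\<dots> = R (Suc (l n)) * (\<alpha> + 1 / n) * n" using n by (simp add: field_simps)
    finally show ?thesis using n by (simp add: pos_divide_le_eq)
  qed
  have R_lim: "R \<longlonglongrightarrow> \<mu>" using lim by (simp add: R_def[abs_def])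
  show "\<forall>\<^sub>F n in sequentially. a < S n / n" if "a < \<mu> / \<alpha>"
  proof -
    have "(\<lambda>n. R (l n) * (1 / \<alpha>)) \<longlonglongrightarrow> \<mu> * (1 / \<alpha>)"
      by (intro tendsto_intros filterlim_compose[OF R_lim l_top])
    then have "\<forall>\<^sub>F n in sequentially. a < R (l n) * (1 / \<alpha>)"
      using that by (intro order_tendstoD) auto
    then show ?thesis
      using eventually_ge_at_top[of 1] by eventually_elim (use lower in force)
  qed
  show "\<forall>\<^sub>F n in sequentially. S n / n < a" if "\<mu> * \<alpha> < a"
  proof -
    have "(\<lambda>n. R (Suc (l n)) * (\<alpha> + 1 / n)) \<longlonglongrightarrow> \<mu> * (\<alpha> + 0)"
      by (intro tendsto_intros lim_1_over_n filterlim_compose[OF LIMSEQ_Suc[OF R_lim] l_top])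
    then have "\<forall>\<^sub>F n in sequentially. R (Suc (l n)) * (\<alpha> + 1 / n) < a"
      using that by (intro order_tendstoD) auto
    then show ?thesis
      using eventually_ge_at_top[of 1] by eventually_elim (use upper in force)
  qed
qed

text \<open>As the ratio tends to 1, both bounds of the sandwich close in on \<open>\<mu>\<close>.
  The ratios form a sequence so that, later, only countably many null sets have to be
  discarded.\<close>

lemma geometric_interpolation:
  fixes S :: "nat \<Rightarrow> real"
  assumes S: "mono S" "\<And>n. 0 \<le> S n"
    and lim: "\<And>j::nat. (\<lambda>n. S (geo (1 + 1 / Suc j) n) / geo (1 + 1 / Suc j) n) \<longlonglongrightarrow> \<mu>"
  shows "(\<lambda>n. S n / n) \<longlonglongrightarrow> \<mu>"
proof (rule order_tendstoI)
  have one: "(\<lambda>j. 1 + 1 / real (Suc j)) \<longlonglongrightarrow> 1 + 0"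
    by (intro tendsto_intros LIMSEQ_Suc lim_1_over_n)
  fix a
  show "\<forall>\<^sub>F n in sequentially. a < S n / n" if "a < \<mu>"
  proof -
    have "(\<lambda>j. \<mu> / (1 + 1 / real (Suc j))) \<longlonglongrightarrow> \<mu> / (1 + 0)"
      by (intro tendsto_divide one tendsto_const) simp
    then have "\<forall>\<^sub>F j in sequentially. a < \<mu> / (1 + 1 / real (Suc j))"
      using that by (intro order_tendstoD) auto
    then obtain j where "a < \<mu> / (1 + 1 / real (Suc j))"
      using eventually_happens'[OF sequentially_bot] by blast
    then show ?thesis by (intro geometric_sandwich(1)[OF _ S lim[of j]]) auto
  qed
  show "\<forall>\<^sub>F n in sequentially. S n / n < a" if "\<mu> < a"
  proof -
    have "(\<lambda>j. \<mu> * (1 + 1 / real (Suc j))) \<longlonglongrightarrow> \<mu> * (1 + 0)"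
      by (intro tendsto_mult one tendsto_const)
    then have "\<forall>\<^sub>F j in sequentially. \<mu> * (1 + 1 / real (Suc j)) < a"
      using that by (intro order_tendstoD) auto
    then obtain j where "\<mu> * (1 + 1 / real (Suc j)) < a"
      using eventually_happens'[OF sequentially_bot] by blast
    then show ?thesis by (intro geometric_sandwich(2)[OF _ S lim[of j]]) auto
  qed
qed

section \<open>The strong law of large numbers for nonnegative variables\<close>

locale nonneg_iid = prob_space +
  fixes X :: "nat \<Rightarrow> 'a \<Rightarrow> real"
  assumes indep: "indep_vars (\<lambda>_. borel) X {1..}"
    and ident: "n \<ge> 1 \<Longrightarrow> distr M borel (X n) = distr M borel (X 1)"
    and nonneg: "n \<ge> 1 \<Longrightarrow> AE \<omega> in M. 0 \<le> X n \<omega>"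
    and integrable_X: "integrable M (X 1)"
begin

section \<open>Identical distribution, truncation and deviation bounds\<close>

lemma measurable_X: "n \<ge> 1 \<Longrightarrow> X n \<in> borel_measurable M"
  using indep by (simp add: indep_vars_def)

lemma measurable_X1 [measurable]: "X 1 \<in> borel_measurable M"
  by (simp add: measurable_X)

lemma expectation_ident:
  fixes f :: "real \<Rightarrow> real"
  assumes "f \<in> borel_measurable borel" "n \<ge> 1"
  shows "expectation (\<lambda>\<omega>. f (X n \<omega>)) = expectation (\<lambda>\<omega>. f (X 1 \<omega>))"
  using integral_distr[OF measurable_X assms(1)] ident assms(2) by (metis order_refl)

lemma prob_ident:
  assumes "A \<in> sets borel" "n \<ge> 1"
  shows "prob {\<omega> \<in> space M. X n \<omega> \<in> A} = prob {\<omega> \<in> space M. X 1 \<omega> \<in> A}"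
proof -
  have "prob {\<omega> \<in> space M. X k \<omega> \<in> A} = measure (distr M borel (X k)) A" if "k \<ge> 1" for k
    using that assms(1) by (simp add: measure_distr measurable_X vimage_def Int_def conj_commute)
  then show ?thesis using ident[OF assms(2)] assms(2) by simp
qed

text \<open>Sending negative arguments to 0 as well gives bounds valid at every sample point,
  although the variables are nonnegative only almost surely.\<close>

definition trunc :: "real \<Rightarrow> real \<Rightarrow> real" where
  "trunc a x = (if 0 \<le> x \<and> x \<le> a then x else 0)"

lemma measurable_trunc [measurable]: "trunc a \<in> borel_measurable borel"
  unfolding trunc_def by measurable

lemma trunc_bounds: "0 \<le> a \<Longrightarrow> 0 \<le> trunc a x" "0 \<le> a \<Longrightarrow> trunc a x \<le> a"
  by (auto simp: trunc_def)

lemma integrable_bounded_image: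
  fixes f :: "real \<Rightarrow> real"
  assumes "f \<in> borel_measurable borel" "\<And>x. \<bar>f x\<bar> \<le> B" "n \<ge> 1"
  shows "integrable M (\<lambda>\<omega>. f (X n \<omega>))"
  by (rule integrable_const_bound[of _ B])
     (use assms measurable_compose[OF measurable_X assms(1)] in auto)

text \<open>The centred truncations \<open>Y i\<close> are bounded and pairwise uncorrelated, so in
  the expanded square only the diagonal survives; each variance there is at most the common second
  moment.\<close>

lemma variance_trunc_sum:
  assumes "0 \<le> a"
  shows "variance (\<lambda>\<omega>. \<Sum>i=1..k. trunc a (X i \<omega>)) \<le> k * expectation (\<lambda>\<omega>. (trunc a (X 1 \<omega>))\<^sup>2)"
proof -
  define m where "m = expectation (\<lambda>\<omega>. trunc a (X 1 \<omega>))"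
  define Y where "Y i = (\<lambda>\<omega>. trunc a (X i \<omega>) - m)" for i
  have m: "expectation (\<lambda>\<omega>. trunc a (X i \<omega>)) = m" if "i \<ge> 1" for i
    unfolding m_def using that by (intro expectation_ident[where f = "trunc a"]) auto
  have int: "integrable M (\<lambda>\<omega>. trunc a (X i \<omega>))" if "i \<ge> 1" for i
    using that assms trunc_bounds by (intro integrable_bounded_image[where f = "trunc a" and B = a]) auto
  have int2: "integrable M (\<lambda>\<omega>. (trunc a (X i \<omega>))\<^sup>2)" if "i \<ge> 1" for i
    using that assms trunc_bounds
    by (intro integrable_bounded_image[where f = "\<lambda>x. (trunc a x)\<^sup>2" and B = "a\<^sup>2"]) (auto intro!: power_mono)
  have intY: "integrable M (Y i)" if "i \<ge> 1" for i
    using int[OF that] by (auto simp: Y_def)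
  have EY: "expectation (Y i) = 0" if "i \<ge> 1" for i
    using int[OF that] m[OF that] by (simp add: Y_def prob_space)
  have intYY: "integrable M (\<lambda>\<omega>. Y i \<omega> * Y j \<omega>)" if "i \<ge> 1" "j \<ge> 1" for i j
  proof (rule integrable_const_bound[of _ "(a + \<bar>m\<bar>) * (a + \<bar>m\<bar>)"])
    have "\<bar>Y i \<omega>\<bar> \<le> a + \<bar>m\<bar>" for i \<omega>
      using trunc_bounds[OF assms, of "X i \<omega>"] by (auto simp: Y_def)
    then show "AE \<omega> in M. norm (Y i \<omega> * Y j \<omega>) \<le> (a + \<bar>m\<bar>) * (a + \<bar>m\<bar>)"
      using assms by (auto simp: abs_mult intro!: AE_I2 mult_mono)
    show "(\<lambda>\<omega>. Y i \<omega> * Y j \<omega>) \<in> borel_measurable M"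
      using intY that by (intro borel_measurable_times) auto
  qed
  have indepY: "indep_vars (\<lambda>_. borel) Y {1..}"
    unfolding Y_def by (rule indep_vars_compose2[OF indep]) simp
  have uncorrelated: "expectation (\<lambda>\<omega>. Y i \<omega> * Y j \<omega>) = 0" if "i \<ge> 1" "j \<ge> 1" "i \<noteq> j" for i j
  proof -
    \<comment> \<open>For \<open>i \<noteq> j\<close> the product over \<open>{i, j}\<close> has two
      distinct factors, and the product rule for independent variables applies.\<close>
    have "expectation (\<lambda>\<omega>. \<Prod>l\<in>{i, j}. Y l \<omega>) = (\<Prod>l\<in>{i, j}. expectation (Y l))"
      using that by (intro indep_vars_lebesgue_integral indep_vars_subset[OF indepY] intY) auto
    then show ?thesis using that EY by simp
  qed
  have diag: "expectation (\<lambda>\<omega>. Y i \<omega> * Y i \<omega>) \<le> expectation (\<lambda>\<omega>. (trunc a (X 1 \<omega>))\<^sup>2)"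
    if "i \<ge> 1" for i
  proof -
    have "expectation (\<lambda>\<omega>. Y i \<omega> * Y i \<omega>) = variance (\<lambda>\<omega>. trunc a (X i \<omega>))"
      using m[OF that] by (simp add: Y_def power2_eq_square)
    also have "\<dots> \<le> expectation (\<lambda>\<omega>. (trunc a (X i \<omega>))\<^sup>2)"
      using int int2 that by (simp add: variance_eq)
    also have "\<dots> = expectation (\<lambda>\<omega>. (trunc a (X 1 \<omega>))\<^sup>2)"
      using that by (intro expectation_ident[where f = "\<lambda>x. (trunc a x)\<^sup>2"]) auto
    finally show ?thesis .
  qed
  have "variance (\<lambda>\<omega>. \<Sum>i=1..k. trunc a (X i \<omega>)) = expectation (\<lambda>\<omega>. (\<Sum>i=1..k. Y i \<omega>)\<^sup>2)"
    using int m by (simp add: Y_def sum_subtractf)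
  also have "\<dots> = expectation (\<lambda>\<omega>. \<Sum>i=1..k. \<Sum>j=1..k. Y i \<omega> * Y j \<omega>)"
    by (simp add: power2_eq_square sum_product)
  also have "\<dots> = (\<Sum>i=1..k. \<Sum>j=1..k. expectation (\<lambda>\<omega>. Y i \<omega> * Y j \<omega>))"
    using intYY by (subst Bochner_Integration.integral_sum)
      (auto intro!: sum.cong Bochner_Integration.integral_sum Bochner_Integration.integrable_sum)
  also have "\<dots> = (\<Sum>i=1..k. \<Sum>j=1..k. if j = i then expectation (\<lambda>\<omega>. Y i \<omega> * Y i \<omega>) else 0)"
    using uncorrelated by (intro sum.cong) auto
  also have "\<dots> = (\<Sum>i=1..k. expectation (\<lambda>\<omega>. Y i \<omega> * Y i \<omega>))"
    by simp
  also have "\<dots> \<le> (\<Sum>i=1..k. expectation (\<lambda>\<omega>. (trunc a (X 1 \<omega>))\<^sup>2))"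
    using diag by (intro sum_mono) auto
  finally show ?thesis by simp
qed

text \<open>Either some \<open>X i\<close> exceeds \<open>a\<close>, which the union bound controls,
  or almost surely the sum equals its truncated version, which Chebyshev controls. The common level
  \<open>a\<close> keeps the truncated variables identically distributed, so the centring is one
  truncated mean.\<close>

lemma prob_truncated_deviation:
  assumes "k \<ge> 1" "0 \<le> a" "0 < \<epsilon>"
  shows "prob {\<omega> \<in> space M. \<epsilon> \<le> \<bar>(\<Sum>i=1..k. X i \<omega>) / k - expectation (\<lambda>\<omega>. trunc a (X 1 \<omega>))\<bar>}
    \<le> k * prob {\<omega> \<in> space M. a < X 1 \<omega>} + expectation (\<lambda>\<omega>. (trunc a (X 1 \<omega>))\<^sup>2) / (k * \<epsilon>\<^sup>2)"
proof -
  define m where "m = expectation (\<lambda>\<omega>. trunc a (X 1 \<omega>))"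
  define T where "T \<omega> = (\<Sum>i=1..k. trunc a (X i \<omega>))" for \<omega>
  have rv [measurable]: "X i \<in> borel_measurable M" if "i \<in> {1..k}" for i
    using that by (simp add: measurable_X)
  have [measurable]: "T \<in> borel_measurable M"
    unfolding T_def by measurable
  define B where "B = (\<Union>i\<in>{1..k}. {\<omega> \<in> space M. a < X i \<omega>})"
  define C where "C = {\<omega> \<in> space M. k * \<epsilon> \<le> \<bar>T \<omega> - expectation T\<bar>}"
  have [measurable]: "B \<in> events" "C \<in> events"
    unfolding B_def C_def by measurable
  have ET: "expectation T = k * m"
  proof -
    have "expectation T = (\<Sum>i=1..k. expectation (\<lambda>\<omega>. trunc a (X i \<omega>)))"
      unfolding T_def using assms(2) trunc_bounds
      by (intro Bochner_Integration.integral_sum integrable_bounded_image[where f = "trunc a" and B = a]) auto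
    also have "\<dots> = (\<Sum>i=1..k. m)"
      unfolding m_def by (intro sum.cong expectation_ident[where f = "trunc a"]) auto
    also have "\<dots> = k * m" by simp
    finally show ?thesis .
  qed
  have "AE \<omega> in M. \<forall>i\<in>{1..k}. 0 \<le> X i \<omega>"
    using nonneg by (intro AE_finite_allI) auto
  \<comment> \<open>The inclusion in \<open>B \<union> C\<close> is only almost sure: truncation
    also alters negative values, which occur with probability 0.\<close>
  then have "AE \<omega> in M. \<omega> \<in> {\<omega> \<in> space M. \<epsilon> \<le> \<bar>(\<Sum>i=1..k. X i \<omega>) / k - m\<bar>} \<longrightarrow> \<omega> \<in> B \<union> C"
  proof (rule AE_mp, intro AE_I2 impI)
    fix \<omega> assume "\<omega> \<in> space M" and nn: "\<forall>i\<in>{1..k}. 0 \<le> X i \<omega>"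
      and \<omega>: "\<omega> \<in> {\<omega> \<in> space M. \<epsilon> \<le> \<bar>(\<Sum>i=1..k. X i \<omega>) / k - m\<bar>}"
    show "\<omega> \<in> B \<union> C"
    proof (cases "\<omega> \<in> B")
      case False
      then have "T \<omega> = (\<Sum>i=1..k. X i \<omega>)"
        using nn \<open>\<omega> \<in> space M\<close> unfolding T_def by (intro sum.cong) (auto simp: trunc_def B_def not_less)
      then have "T \<omega> - expectation T = k * ((\<Sum>i=1..k. X i \<omega>) / k - m)"
        using assms(1) by (simp add: ET right_diff_distrib)
      then show ?thesis using \<omega> by (auto simp: C_def abs_mult intro: mult_left_mono)
    qed simp
  qed
  then have "prob {\<omega> \<in> space M. \<epsilon> \<le> \<bar>(\<Sum>i=1..k. X i \<omega>) / k - m\<bar>} \<le> prob (B \<union> C)"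
    by (rule finite_measure_mono_AE) measurable
  also have "\<dots> \<le> prob B + prob C"
    by (rule measure_Un_le) measurable
  also have "prob B \<le> (\<Sum>i=1..k. prob {\<omega> \<in> space M. a < X i \<omega>})"
    unfolding B_def by (rule finite_measure_subadditive_finite) auto
  also have "\<dots> = (\<Sum>i=1..k. prob {\<omega> \<in> space M. a < X 1 \<omega>})"
  proof (rule sum.cong)
    fix i assume "i \<in> {1..k}"
    then show "prob {\<omega> \<in> space M. a < X i \<omega>} = prob {\<omega> \<in> space M. a < X 1 \<omega>}"
      using prob_ident[of "{a<..}" i] by simp
  qed simp
  also have "\<dots> = k * prob {\<omega> \<in> space M. a < X 1 \<omega>}"
    by simp
  also have "prob C \<le> variance T / (k * \<epsilon>)\<^sup>2"
    unfolding C_def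
  proof (rule Chebyshev_inequality)
    show "integrable M (\<lambda>\<omega>. (T \<omega>)\<^sup>2)"
    proof (rule integrable_const_bound[of _ "(k * a)\<^sup>2"])
      have "0 \<le> T \<omega>" "T \<omega> \<le> k * a" for \<omega>
        using sum_bounded_above[of "{1..k}" "\<lambda>i. trunc a (X i \<omega>)" a] trunc_bounds[OF assms(2)]
        by (auto simp: T_def sum_nonneg)
      then show "AE \<omega> in M. norm ((T \<omega>)\<^sup>2) \<le> (k * a)\<^sup>2"
        by (auto intro!: AE_I2 power_mono)
    qed measurable
  qed (use assms in auto)
  also have "\<dots> \<le> k * expectation (\<lambda>\<omega>. (trunc a (X 1 \<omega>))\<^sup>2) / (k * \<epsilon>)\<^sup>2"
    unfolding T_def using variance_trunc_sum[OF assms(2)] by (intro divide_right_mono) auto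
  also have "\<dots> = expectation (\<lambda>\<omega>. (trunc a (X 1 \<omega>))\<^sup>2) / (k * \<epsilon>\<^sup>2)"
    using assms by (simp add: power2_eq_square)
  finally show ?thesis by (simp add: m_def)
qed

section \<open>Summability of the error terms and almost sure convergence\<close>

lemma AE_nonneg: "AE \<omega> in M. 0 \<le> X 1 \<omega>"
  by (simp add: nonneg)

text \<open>Each term is the expectation of \<open>\<alpha> ^ n\<close> on the event
  \<open>\<alpha> ^ n < X 1\<close>. Summing under the expectation, \<open>sum_powers_below\<close>
  bounds all partial sums by a multiple of the mean.\<close>

lemma summable_tail:
  assumes "1 < \<alpha>"
  shows "summable (\<lambda>n. \<alpha> ^ n * prob {\<omega> \<in> space M. \<alpha> ^ n < X 1 \<omega>})"
proof (rule summableI_nonneg_bounded)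
  fix N
  define f where "f n \<omega> = (if \<alpha> ^ n < X 1 \<omega> then \<alpha> ^ n else 0)" for n \<omega>
  have int: "integrable M (f n)" for n
  proof (rule integrable_const_bound[of _ "\<alpha> ^ n"])
    show "f n \<in> borel_measurable M" unfolding f_def by measurable
  qed (use assms in \<open>auto simp: f_def\<close>)
  have "expectation (f n) = \<alpha> ^ n * prob {\<omega> \<in> space M. \<alpha> ^ n < X 1 \<omega>}" for n
  proof -
    have "expectation (f n) = expectation (\<lambda>\<omega>. \<alpha> ^ n * indicat_real {\<omega> \<in> space M. \<alpha> ^ n < X 1 \<omega>} \<omega>)"
      by (intro Bochner_Integration.integral_cong) (auto simp: f_def)
    moreover have "{\<omega> \<in> space M. \<alpha> ^ n < X 1 \<omega>} \<inter> space M = {\<omega> \<in> space M. \<alpha> ^ n < X 1 \<omega>}"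
      by auto
    ultimately show ?thesis by (simp del: One_nat_def)
  qed
  then have "(\<Sum>n<N. \<alpha> ^ n * prob {\<omega> \<in> space M. \<alpha> ^ n < X 1 \<omega>}) = (\<Sum>n<N. expectation (f n))"
    by simp
  also have "\<dots> = expectation (\<lambda>\<omega>. \<Sum>n<N. f n \<omega>)"
    using int by simp
  also have "\<dots> \<le> expectation (\<lambda>\<omega>. \<alpha> / (\<alpha> - 1) * X 1 \<omega>)"
  proof (rule integral_mono_AE)
    show "AE \<omega> in M. (\<Sum>n<N. f n \<omega>) \<le> \<alpha> / (\<alpha> - 1) * X 1 \<omega>"
      using AE_nonneg by eventually_elim (use sum_powers_below assms in \<open>simp add: f_def\<close>)
  qed (use int integrable_X in auto)
  finally show "(\<Sum>n<N. \<alpha> ^ n * prob {\<omega> \<in> space M. \<alpha> ^ n < X 1 \<omega>})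
    \<le> expectation (\<lambda>\<omega>. \<alpha> / (\<alpha> - 1) * X 1 \<omega>)" .
qed (use assms in auto)

text \<open>The same exchange of sum and expectation, now with
  \<open>sum_inverse_powers_above\<close>, so a finite first moment controls these second
  moments.\<close>

lemma summable_trunc_square:
  assumes "1 < \<alpha>"
  shows "summable (\<lambda>n. expectation (\<lambda>\<omega>. (trunc (\<alpha> ^ n) (X 1 \<omega>))\<^sup>2) / \<alpha> ^ n)"
proof (rule summableI_nonneg_bounded)
  fix N
  have int: "integrable M (\<lambda>\<omega>. (trunc (\<alpha> ^ n) (X 1 \<omega>))\<^sup>2)" for n
    using assms trunc_bounds[of "\<alpha> ^ n"]
    by (intro integrable_bounded_image[where f = "\<lambda>x. (trunc (\<alpha> ^ n) x)\<^sup>2" and B = "(\<alpha> ^ n)\<^sup>2"])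
      (auto simp del: power2_abs intro!: power_mono)
  have "(\<Sum>n<N. expectation (\<lambda>\<omega>. (trunc (\<alpha> ^ n) (X 1 \<omega>))\<^sup>2) / \<alpha> ^ n)
      = expectation (\<lambda>\<omega>. \<Sum>n<N. (trunc (\<alpha> ^ n) (X 1 \<omega>))\<^sup>2 / \<alpha> ^ n)"
    using int by simp
  also have "\<dots> \<le> expectation (\<lambda>\<omega>. \<alpha> / (\<alpha> - 1) * X 1 \<omega>)"
  proof (rule integral_mono_AE)
    show "AE \<omega> in M. (\<Sum>n<N. (trunc (\<alpha> ^ n) (X 1 \<omega>))\<^sup>2 / \<alpha> ^ n) \<le> \<alpha> / (\<alpha> - 1) * X 1 \<omega>"
      using AE_nonneg
    proof eventually_elim
      case (elim \<omega>)
      have "(\<Sum>n<N. (trunc (\<alpha> ^ n) (X 1 \<omega>))\<^sup>2 / \<alpha> ^ n)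
          = (\<Sum>n<N. if X 1 \<omega> \<le> \<alpha> ^ n then (X 1 \<omega>)\<^sup>2 / \<alpha> ^ n else 0)"
        using elim by (intro sum.cong) (auto simp: trunc_def)
      then show ?case using sum_inverse_powers_above[OF assms elim] by simp
    qed
  qed (use int integrable_X in auto)
  finally show "(\<Sum>n<N. expectation (\<lambda>\<omega>. (trunc (\<alpha> ^ n) (X 1 \<omega>))\<^sup>2) / \<alpha> ^ n)
    \<le> expectation (\<lambda>\<omega>. \<alpha> / (\<alpha> - 1) * X 1 \<omega>)" .
qed (use assms in auto)

text \<open>Dominated convergence: at each nonnegative value the truncation is inactive once
  \<open>\<alpha> ^ n\<close> has passed it.\<close>

lemma expectation_trunc_tendsto:
  assumes "1 < \<alpha>"
  shows "(\<lambda>n. expectation (\<lambda>\<omega>. trunc (\<alpha> ^ n) (X 1 \<omega>))) \<longlonglongrightarrow> expectation (X 1)"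
proof (rule integral_dominated_convergence[where w = "\<lambda>\<omega>. \<bar>X 1 \<omega>\<bar>"])
  show "AE \<omega> in M. (\<lambda>n. trunc (\<alpha> ^ n) (X 1 \<omega>)) \<longlonglongrightarrow> X 1 \<omega>"
    using AE_nonneg
  proof eventually_elim
    case (elim \<omega>)
    obtain n0 where n0: "X 1 \<omega> < \<alpha> ^ n0" using real_arch_pow[OF assms] by blast
    have "\<forall>\<^sub>F n in sequentially. trunc (\<alpha> ^ n) (X 1 \<omega>) = X 1 \<omega>"
      using eventually_ge_at_top[of n0]
    proof eventually_elim
      fix n assume "n0 \<le> n"
      then have "\<alpha> ^ n0 \<le> \<alpha> ^ n" using assms by (intro power_increasing) auto
      then show "trunc (\<alpha> ^ n) (X 1 \<omega>) = X 1 \<omega>" using n0 elim by (simp add: trunc_def)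
    qed
    then show ?case by (rule tendsto_eventually)
  qed
qed (use integrable_X in \<open>auto simp: trunc_def\<close>)

text \<open>Borel-Cantelli: for each \<open>\<epsilon>\<close> the deviation events
  \<open>A \<epsilon> n\<close> have summable probabilities, so almost surely only finitely many of
  them occur.\<close>

lemma strong_law_geometric:
  assumes "1 < \<alpha>"
  shows "AE \<omega> in M. (\<lambda>n. (\<Sum>i=1..geo \<alpha> n. X i \<omega>) / geo \<alpha> n) \<longlonglongrightarrow> expectation (X 1)"
proof -
  define m where "m n = expectation (\<lambda>\<omega>. trunc (\<alpha> ^ n) (X 1 \<omega>))" for n
  define R where "R n \<omega> = (\<Sum>i=1..geo \<alpha> n. X i \<omega>) / geo \<alpha> n" for n \<omega>
  define A where "A \<epsilon> n = {\<omega> \<in> space M. \<epsilon> \<le> \<bar>R n \<omega> - m n\<bar>}" for \<epsilon> n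
  have geo: "\<alpha> ^ n \<le> geo \<alpha> n" "geo \<alpha> n \<le> 2 * \<alpha> ^ n" "0 < \<alpha> ^ n" "geo \<alpha> n \<ge> 1" for n
  proof -
    have "1 \<le> \<alpha> ^ n" using assms by (intro one_le_power) simp
    moreover from this have "1 \<le> real (geo \<alpha> n)" using geo_bounds(1)[OF assms, of n] by linarith
    ultimately show "\<alpha> ^ n \<le> geo \<alpha> n" "geo \<alpha> n \<le> 2 * \<alpha> ^ n" "0 < \<alpha> ^ n" "geo \<alpha> n \<ge> 1"
      using geo_bounds[OF assms, of n] by auto
  qed
  have meas: "A \<epsilon> n \<in> events" for \<epsilon> n
  proof -
    have [measurable]: "X i \<in> borel_measurable M" if "i \<in> {1..geo \<alpha> n}" for i
      using that by (simp add: measurable_X)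
    show ?thesis unfolding A_def R_def by measurable
  qed
  have sum: "summable (\<lambda>n. prob (A \<epsilon> n))" if "0 < \<epsilon>" for \<epsilon>
  proof (rule summable_comparison_test)
    \<comment> \<open>The factor 2 comes from
      \<open>geo \<alpha> n \<le> \<alpha> ^ n + 1 \<le> 2 * \<alpha> ^ n\<close>; in the
      denominator \<open>geo \<alpha> n\<close> is bounded below by
      \<open>\<alpha> ^ n\<close>.\<close>
    let ?b = "\<lambda>n. 2 * (\<alpha> ^ n * prob {\<omega> \<in> space M. \<alpha> ^ n < X 1 \<omega>})
        + expectation (\<lambda>\<omega>. (trunc (\<alpha> ^ n) (X 1 \<omega>))\<^sup>2) / \<alpha> ^ n / \<epsilon>\<^sup>2"
    show "summable ?b"
      using summable_tail summable_trunc_square assms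
      by (intro summable_add summable_mult summable_divide) auto
    have "prob (A \<epsilon> n) \<le> ?b n" for n
    proof -
      have "prob (A \<epsilon> n) \<le> geo \<alpha> n * prob {\<omega> \<in> space M. \<alpha> ^ n < X 1 \<omega>}
          + expectation (\<lambda>\<omega>. (trunc (\<alpha> ^ n) (X 1 \<omega>))\<^sup>2) / (geo \<alpha> n * \<epsilon>\<^sup>2)"
        unfolding A_def R_def m_def using geo[of n] that by (intro prob_truncated_deviation) auto
      also have "\<dots> \<le> 2 * \<alpha> ^ n * prob {\<omega> \<in> space M. \<alpha> ^ n < X 1 \<omega>}
          + expectation (\<lambda>\<omega>. (trunc (\<alpha> ^ n) (X 1 \<omega>))\<^sup>2) / (\<alpha> ^ n * \<epsilon>\<^sup>2)"
        using geo[of n] that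
        by (intro add_mono mult_right_mono divide_left_mono mult_pos_pos) auto
      finally show ?thesis by (simp add: mult.assoc)
    qed
    then show "\<exists>N. \<forall>n\<ge>N. norm (prob (A \<epsilon> n)) \<le> ?b n" by auto
  qed
  have "AE \<omega> in M. \<forall>\<^sub>F n in sequentially. \<bar>R n \<omega> - m n\<bar> < \<epsilon>" if "0 < \<epsilon>" for \<epsilon>
  proof -
    have "AE \<omega> in M. \<forall>\<^sub>F n in sequentially. \<omega> \<in> space M - A \<epsilon> n"
      by (rule borel_cantelli_AE1[OF meas _ sum[OF that]]) (simp add: emeasure_eq_measure)
    then show ?thesis
      by (rule AE_mp) (auto simp: A_def not_le intro!: AE_I2 elim!: eventually_mono)
  qed
  \<comment> \<open>Restricting to the tolerances \<open>1 / Suc j\<close> leaves a single null set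
    outside which every tolerance is met.\<close>
  then have "AE \<omega> in M. \<forall>j::nat. \<forall>\<^sub>F n in sequentially. \<bar>R n \<omega> - m n\<bar> < 1 / Suc j"
    by (simp add: AE_all_countable)
  then have "AE \<omega> in M. (\<lambda>n. R n \<omega>) \<longlonglongrightarrow> expectation (X 1)"
  proof eventually_elim
    case (elim \<omega>)
    have "(\<lambda>n. R n \<omega> - m n) \<longlonglongrightarrow> 0"
    proof (rule tendstoI)
      fix e :: real assume "0 < e"
      then obtain j where j: "1 / real (Suc j) < e" using nat_approx_posE by blast
      show "\<forall>\<^sub>F n in sequentially. dist (R n \<omega> - m n) 0 < e"
        using elim[rule_format, of j] by eventually_elim (use j in \<open>auto simp: dist_real_def\<close>)
    qed
    \<comment> \<open>The deviations were measured from the moving truncated means, which converge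
      to the mean.\<close>
    from tendsto_add[OF this expectation_trunc_tendsto[OF assms]]
    show ?case by (simp add: m_def)
  qed
  then show ?thesis by (simp add: R_def)
qed

text \<open>Outside countably many null sets, all terms are nonnegative, so the partial sums are
  monotone, and the averages converge along every ratio \<open>1 + 1 / Suc j\<close>; interpolation
  then works path by path.\<close>

theorem strong_law: "AE \<omega> in M. (\<lambda>n. (\<Sum>i=1..n. X i \<omega>) / n) \<longlonglongrightarrow> expectation (X 1)"
proof -
  have "AE \<omega> in M. \<forall>j::nat. (\<lambda>n. (\<Sum>i=1..geo (1 + 1 / Suc j) n. X i \<omega>) / geo (1 + 1 / Suc j) n)
      \<longlonglongrightarrow> expectation (X 1)"
    unfolding AE_all_countable by (intro allI strong_law_geometric) simp
  moreover have "AE \<omega> in M. \<forall>n::nat. n \<ge> 1 \<longrightarrow> 0 \<le> X n \<omega>"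
    unfolding AE_all_countable using nonneg by auto
  ultimately show ?thesis
  proof eventually_elim
    case (elim \<omega>)
    have "mono (\<lambda>n. \<Sum>i=1..n. X i \<omega>)"
      using elim(2) by (intro monoI sum_mono2) auto
    moreover have "0 \<le> (\<Sum>i=1..n. X i \<omega>)" for n
      using elim(2) by (intro sum_nonneg) auto
    ultimately show ?case
      using elim(1) by (intro geometric_interpolation[where S = "\<lambda>n. \<Sum>i=1..n. X i \<omega>"]) auto
  qed
qed

end

section \<open>From the strong law at each server to the mean cycle time\<close>

theorem theorem7:
  fixes P :: "'a measure" and M :: nat and \<tau> :: "nat \<Rightarrow> nat \<Rightarrow> 'a \<Rightarrow> real"
  assumes "prob_space P"
    and "M \<ge> 1"
    and sequences_independent:
      "prob_space.indep_vars P (\<lambda>i. \<Pi>\<^sub>M n\<in>{1::nat..}. (borel :: real measure))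
         (\<lambda>i \<omega>. \<lambda>n\<in>{1::nat..}. \<tau> i n \<omega>) {0..M}"
    and independent:
      "\<And>i. i \<le> M \<Longrightarrow> prob_space.indep_vars P (\<lambda>n. borel) (\<tau> i) {1..}"
    and identically_distributed:
      "\<And>i n. i \<le> M \<Longrightarrow> n \<ge> 1 \<Longrightarrow> distr P borel (\<tau> i n) = distr P borel (\<tau> i 1)"
    and nonnegative:
      "\<And>i n. i \<le> M \<Longrightarrow> n \<ge> 1 \<Longrightarrow> AE \<omega> in P. 0 \<le> \<tau> i n \<omega>"
    and finite_mean:
      "\<And>i. i \<le> M \<Longrightarrow> integrable P (\<tau> i 1) \<and> 0 \<le> prob_space.expectation P (\<tau> i 1)"
  shows "\<exists>\<gamma>::real.
      (AE \<omega> in P. (\<lambda>n. departure (\<lambda>i k. \<tau> i k \<omega>) M n / real n) \<longlonglongrightarrow> \<gamma>) \<and>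
      ((\<forall>i\<le>M. integrable P (\<lambda>\<omega>. (\<tau> i 1 \<omega> - prob_space.expectation P (\<tau> i 1))\<^sup>2)) \<longrightarrow>
         \<gamma> = Max ((\<lambda>i. prob_space.expectation P (\<tau> i 1)) ` {0..M}))"
proof -
  define \<mu> where "\<mu> i = prob_space.expectation P (\<tau> i 1)" for i
  have "AE \<omega> in P. (\<lambda>n. (\<Sum>k=1..n. \<tau> i k \<omega>) / n) \<longlonglongrightarrow> \<mu> i" if "i \<le> M" for i
  proof -
    interpret nonneg_iid P "\<tau> i"
      by (intro nonneg_iid.intro nonneg_iid_axioms.intro assms(1) independent[OF that]
          identically_distributed[OF that] nonnegative[OF that] conjunct1[OF finite_mean[OF that]])
    show ?thesis using strong_law by (simp add: \<mu>_def)
  qed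
  \<comment> \<open>With finitely many servers, one null set serves them all; outside it the
    deterministic rate of \<open>departure_rate\<close> applies.\<close>
  then have "AE \<omega> in P. \<forall>i\<in>{0..M}. (\<lambda>n. (\<Sum>k=1..n. \<tau> i k \<omega>) / n) \<longlonglongrightarrow> \<mu> i"
    by (intro AE_finite_allI) auto
  then have "AE \<omega> in P. (\<lambda>n. departure (\<lambda>i k. \<tau> i k \<omega>) M n / real n) \<longlonglongrightarrow> Max (\<mu> ` {0..M})"
    by eventually_elim (rule departure_rate, simp)
  \<comment> \<open>The maximum of the means is the witness for \<open>\<gamma>\<close> in both
    conjuncts.\<close>
  then show ?thesis unfolding \<mu>_def by blast
qed

end
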